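(* Let $q\geq 2$, identify $Q=\{1,\ldots,q\}$, and let $T$ be a subgroup of $S_q$. Then the permutation code $C(T)$ is diagonally neighbour transitive in $H(q,q)$ if and only if the normaliser $N_{S_q}(T)=\{x\in S_q: T^x=T\}$ acts $2$-transitively on $\{1,\ldots,q\}$. Moreover, for any positive integer $p$, if $C(T)$ is diagonally neighbour transitive in $H(q,q)$, then $\mathrm{Rep}_p(C(T))$ is a diagonally neighbour transitive frequency permutation array in $H(pq,q)$.
   Context: The Hamming graph $H(m,q)$ has vertex set $Q^m$, two vertices adjacent iff they differ in exactly one entry. Its automorphism group is $B\rtimes L$ with $B\cong S_q^m$, $L\cong S_m$, where $(g_1,\ldots,g_m)\in B$ acts by $\alpha^g=(\alpha_1^{g_1},\ldots,\alpha_m^{g_m})$ and $\sigma\in L$ acts by $\alpha^\sigma=(\alpha_{1\sigma^{-1}},\ldots,\alpha_{m\sigma^{-1}})$; $\mathrm{Diag}_m(S_q)=\{(h,\ldots,h)\in B:h\in S_q\}$. A code is a subset $C$ of vertices; its set of neighbours $C_1$ is the set of non-codewords adjacent to some codeword. $C$ is $X$-neighbour transitive ($X$ a group of automorphisms) if $C$ and $C_1$ are both $X$-orbits, and diagonally neighbour transitive if this holds for some $X\leq\mathrm{Diag}_m(S_q)\rtimes L$. For $t\in S_q$, $\alpha(t)=(1^t,\ldots,q^t)\in V(H(q,q))$, and $C(T)=\{\alpha(t):t\in T\}$. Vertices of $H(pq,q)$ are identified with $p$-tuples of vertices of $H(q,q)$ (concatenation); for $\alpha\in V(H(q,q))$,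 $\mathrm{rep}_p(\alpha)=(\alpha,\ldots,\alpha)$ ($p$ copies), and $\mathrm{Rep}_p(C)=\{\mathrm{rep}_p(\alpha):\alpha\in C\}$. A frequency permutation array in $H(pq,q)$ is a code in which every letter of $Q$ occurs exactly $p$ times in each codeword. *)

theory Defs
  imports "HOL-Algebra.Sym_Groups" "HOL-Algebra.Group_Action"
begin

text \<open>
  The alphabet is \<open>Q = {1..q}\<close> and the entries of a vertex are indexed by \<open>{1..m}\<close>; vertices are
  extensional functions.  Permutations act on the right in the mathematical convention, whereas
  \<^const>\<open>sym_group\<close> and \<^const>\<open>BijGroup\<close> multiply by composition of functions (right factor first).
  So the product \<open>g h\<close> of right actions is \<open>h \<circ> g\<close> here; subgroups and orbits are the same
  for both conventions, and the conjugate \<open>T\<^sup>x = x\<^sup>-\<^sup>1 T x\<close> of the right-action convention is the set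
  \<open>x \<circ> T \<circ> x\<^sup>-\<^sup>1\<close> of functions, which is the one in the library's \<^const>\<open>normalizer\<close>.
\<close>

definition hamming_verts :: "nat \<Rightarrow> nat \<Rightarrow> (nat \<Rightarrow> nat) set" where
  "hamming_verts m q = {1..m} \<rightarrow>\<^sub>E {1..q}"

definition hamming_adj :: "nat \<Rightarrow> nat \<Rightarrow> (nat \<Rightarrow> nat) \<Rightarrow> (nat \<Rightarrow> nat) \<Rightarrow> bool" where
  "hamming_adj m q \<alpha> \<beta> \<longleftrightarrow>
     \<alpha> \<in> hamming_verts m q \<and> \<beta> \<in> hamming_verts m q \<and> card {i \<in> {1..m}. \<alpha> i \<noteq> \<beta> i} = 1"

definition hamming_aut :: "nat \<Rightarrow> nat \<Rightarrow> ((nat \<Rightarrow> nat) \<Rightarrow> (nat \<Rightarrow> nat)) monoid" where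
  "hamming_aut m q = (BijGroup (hamming_verts m q))
     \<lparr>carrier := {f \<in> Bij (hamming_verts m q).
        \<forall>\<alpha>\<in>hamming_verts m q. \<forall>\<beta>\<in>hamming_verts m q.
          hamming_adj m q (f \<alpha>) (f \<beta>) \<longleftrightarrow> hamming_adj m q \<alpha> \<beta>}\<rparr>"

definition base_act :: "nat \<Rightarrow> nat \<Rightarrow> (nat \<Rightarrow> nat \<Rightarrow> nat) \<Rightarrow> (nat \<Rightarrow> nat) \<Rightarrow> (nat \<Rightarrow> nat)" where
  "base_act m q g = (\<lambda>\<alpha>\<in>hamming_verts m q. \<lambda>i\<in>{1..m}. g i (\<alpha> i))"

definition coord_act :: "nat \<Rightarrow> nat \<Rightarrow> (nat \<Rightarrow> nat) \<Rightarrow> (nat \<Rightarrow> nat) \<Rightarrow> (nat \<Rightarrow> nat)" where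
  "coord_act m q \<sigma> = (\<lambda>\<alpha>\<in>hamming_verts m q. \<lambda>i\<in>{1..m}. \<alpha> (inv' \<sigma> i))"

definition diag_group :: "nat \<Rightarrow> nat \<Rightarrow> ((nat \<Rightarrow> nat) \<Rightarrow> (nat \<Rightarrow> nat)) set" where
  "diag_group m q = {base_act m q (\<lambda>_. h) | h. h \<in> carrier (sym_group q)}"

definition coord_group :: "nat \<Rightarrow> nat \<Rightarrow> ((nat \<Rightarrow> nat) \<Rightarrow> (nat \<Rightarrow> nat)) set" where
  "coord_group m q = {coord_act m q \<sigma> | \<sigma>. \<sigma> \<in> carrier (sym_group m)}"

text \<open>
  \<open>Diag\<^sub>m(S\<^sub>q) \<rtimes> L\<close>, as an internal product of groups of automorphisms.  The element
  \<open>h \<sigma>\<close> of the right action is the function \<open>\<sigma> \<circ> h\<close>, hence the order of the factors.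
\<close>

definition diag_semidirect :: "nat \<Rightarrow> nat \<Rightarrow> ((nat \<Rightarrow> nat) \<Rightarrow> (nat \<Rightarrow> nat)) set" where
  "diag_semidirect m q = coord_group m q <#>\<^bsub>hamming_aut m q\<^esub> diag_group m q"

definition code_neighbours :: "nat \<Rightarrow> nat \<Rightarrow> (nat \<Rightarrow> nat) set \<Rightarrow> (nat \<Rightarrow> nat) set" where
  "code_neighbours m q C = {\<beta> \<in> hamming_verts m q. \<beta> \<notin> C \<and> (\<exists>\<alpha>\<in>C. hamming_adj m q \<alpha> \<beta>)}"

definition neighbour_transitive ::
  "nat \<Rightarrow> nat \<Rightarrow> ((nat \<Rightarrow> nat) \<Rightarrow> (nat \<Rightarrow> nat)) set \<Rightarrow> (nat \<Rightarrow> nat) set \<Rightarrow> bool" where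
  "neighbour_transitive m q X C \<longleftrightarrow>
     C \<subseteq> hamming_verts m q \<and>
     subgroup X (hamming_aut m q) \<and>
     C \<in> orbits ((hamming_aut m q)\<lparr>carrier := X\<rparr>) (hamming_verts m q) id \<and>
     code_neighbours m q C \<in> orbits ((hamming_aut m q)\<lparr>carrier := X\<rparr>) (hamming_verts m q) id"

definition diagonally_neighbour_transitive :: "nat \<Rightarrow> nat \<Rightarrow> (nat \<Rightarrow> nat) set \<Rightarrow> bool" where
  "diagonally_neighbour_transitive m q C \<longleftrightarrow>
     (\<exists>X. X \<subseteq> diag_semidirect m q \<and> neighbour_transitive m q X C)"

definition perm_vertex :: "nat \<Rightarrow> (nat \<Rightarrow> nat) \<Rightarrow> (nat \<Rightarrow> nat)" where
  "perm_vertex q t = (\<lambda>i\<in>{1..q}. t i)"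

definition perm_code :: "nat \<Rightarrow> (nat \<Rightarrow> nat) set \<Rightarrow> (nat \<Rightarrow> nat) set" where
  "perm_code q T = perm_vertex q ` T"

text \<open>Concatenation of the \<open>p\<close>-tuple \<open>a 1, \<dots>, a p\<close> of vertices with \<open>n\<close> entries each.\<close>

definition concat_verts :: "nat \<Rightarrow> nat \<Rightarrow> (nat \<Rightarrow> nat \<Rightarrow> nat) \<Rightarrow> (nat \<Rightarrow> nat)" where
  "concat_verts p n a = (\<lambda>k\<in>{1..p * n}. a ((k - 1) div n + 1) ((k - 1) mod n + 1))"

definition rep_vertex :: "nat \<Rightarrow> nat \<Rightarrow> (nat \<Rightarrow> nat) \<Rightarrow> (nat \<Rightarrow> nat)" where
  "rep_vertex p n \<alpha> = concat_verts p n (\<lambda>_. \<alpha>)"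

definition Rep_code :: "nat \<Rightarrow> nat \<Rightarrow> (nat \<Rightarrow> nat) set \<Rightarrow> (nat \<Rightarrow> nat) set" where
  "Rep_code p n C = rep_vertex p n ` C"

definition frequency_permutation_array :: "nat \<Rightarrow> nat \<Rightarrow> (nat \<Rightarrow> nat) set \<Rightarrow> bool" where
  "frequency_permutation_array p q C \<longleftrightarrow>
     C \<subseteq> hamming_verts (p * q) q \<and>
     (\<forall>\<alpha>\<in>C. \<forall>a\<in>{1..q}. card {i \<in> {1..p * q}. \<alpha> i = a} = p)"

definition two_transitive_on :: "('a \<Rightarrow> 'a) set \<Rightarrow> 'a set \<Rightarrow> bool" where
  "two_transitive_on N \<Omega> \<longleftrightarrow>
     (\<forall>i\<in>\<Omega>. \<forall>j\<in>\<Omega>. \<forall>k\<in>\<Omega>. \<forall>l\<in>\<Omega>. i \<noteq> j \<and> k \<noteq> l \<longrightarrow> (\<exists>x\<in>N. x i = k \<and> x j = l))"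

end

theory Submission
  imports Defs
begin

text \<open>
  The element of \<open>Diag\<^sub>m(S\<^sub>q) \<rtimes> L\<close> given by \<open>h\<close> and \<open>\<sigma>\<close> sends the word of \<open>t\<close> to the word of
  \<open>h t \<sigma>\<^sup>-\<^sup>1\<close> (composition of functions).  If it preserves \<open>C(T)\<close>, then \<open>h T \<sigma>\<^sup>-\<^sup>1 = T\<close>; taking \<open>t = 1\<close>
  gives \<open>h \<sigma>\<^sup>-\<^sup>1 \<in> T\<close>, so \<open>h\<close> normalises \<open>T\<close>.  A neighbour of a codeword misses exactly one letter and
  repeats exactly one, and \<open>h\<close> moves this ordered pair, so transitivity on neighbours forces
  2-transitivity of the normaliser.

  Conversely, given two neighbours of the words of \<open>t\<close> and \<open>s\<close>, choose \<open>h\<close> in the normaliser moving one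
  pair (replaced letter, new letter) to the other, and \<open>\<sigma> = s\<^sup>-\<^sup>1 h t\<close>.  For the repeated code it suffices
  that \<open>\<sigma>\<close> induces \<open>s\<^sup>-\<^sup>1 h t\<close> on positions within a block; it can still be corrected by a transposition
  of two positions carrying the same letter to match the changed entries.  The group used is the
  full setwise stabiliser of the code, and \<open>p = 1\<close> is the original code.
\<close>

section \<open>Diagonal automorphisms\<close>

text \<open>The product of a coordinate permutation and a diagonal element as one formula,
  restricted to vertices so that it can lie in \<open>Bij\<close>.\<close>

definition diag_act ::
  "nat \<Rightarrow> nat \<Rightarrow> (nat \<Rightarrow> nat) \<Rightarrow> (nat \<Rightarrow> nat) \<Rightarrow> (nat \<Rightarrow> nat) \<Rightarrow> (nat \<Rightarrow> nat)" where
  "diag_act m q h \<sigma> = (\<lambda>\<alpha>\<in>hamming_verts m q. \<lambda>i\<in>{1..m}. h (\<alpha> (inv' \<sigma> i)))"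

lemma permutes_inv_in_iff:
  "\<sigma> permutes S \<Longrightarrow> inv' \<sigma> i \<in> S \<longleftrightarrow> i \<in> S"
  by (rule permutes_in_image[OF permutes_inv])

lemma finite_hamming_verts: "finite (hamming_verts m q)"
  unfolding hamming_verts_def by (intro finite_PiE) auto

lemma hamming_verts_fun_upd:
  assumes "\<alpha> \<in> hamming_verts m q" "k \<in> {1..m}" "b \<in> {1..q}"
  shows "\<alpha>(k := b) \<in> hamming_verts m q"
  using assms by (auto simp: hamming_verts_def PiE_iff extensional_def)

lemma diag_act_apply:
  "\<alpha> \<in> hamming_verts m q \<Longrightarrow> i \<in> {1..m} \<Longrightarrow> diag_act m q h \<sigma> \<alpha> i = h (\<alpha> (inv' \<sigma> i))"
  by (simp add: diag_act_def)

lemma diag_act_in_verts: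
  assumes "h permutes {1..q}" "\<sigma> permutes {1..m}" "\<alpha> \<in> hamming_verts m q"
  shows "diag_act m q h \<sigma> \<alpha> \<in> hamming_verts m q"
proof -
  have "h (\<alpha> (inv' \<sigma> i)) \<in> {1..q}" if "i \<in> {1..m}" for i
  proof -
    have "inv' \<sigma> i \<in> {1..m}"
      using that assms(2) by (simp only: permutes_inv_in_iff)
    then have "\<alpha> (inv' \<sigma> i) \<in> {1..q}"
      using assms(3) unfolding hamming_verts_def by (rule PiE_mem[rotated])
    then show ?thesis
      using assms(1) by (simp only: permutes_in_image)
  qed
  then show ?thesis
    using assms(3) by (simp add: diag_act_def hamming_verts_def)
qed

text \<open>Tracks a neighbour of a codeword: the position of the changed entry moves by
  \<open>\<sigma>\<close> and the new letter moves by \<open>h\<close>.\<close>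

lemma diag_act_fun_upd:
  assumes "h permutes {1..q}" "\<sigma> permutes {1..m}" "\<alpha> \<in> hamming_verts m q"
    and "k \<in> {1..m}" "b \<in> {1..q}"
  shows "diag_act m q h \<sigma> (\<alpha>(k := b)) = (diag_act m q h \<sigma> \<alpha>)(\<sigma> k := h b)"
proof -
  have "\<sigma> k \<in> {1..m}"
    using assms(2,4) by (simp only: permutes_in_image)
  moreover have "inv' \<sigma> i = k \<longleftrightarrow> i = \<sigma> k" for i
    using permutes_inv_eq[OF assms(2)] by auto
  ultimately show ?thesis
    using assms(3) hamming_verts_fun_upd[OF assms(3,4,5)]
    by (auto simp: diag_act_def fun_eq_iff)
qed

text \<open>As \<open>h\<close> is the same at every coordinate, it commutes with all coordinate
  permutations, so pairs compose componentwise without a twist.\<close>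

lemma diag_act_compose:
  assumes "h' permutes {1..q}" "\<sigma> permutes {1..m}" "\<sigma>' permutes {1..m}"
  shows "compose (hamming_verts m q) (diag_act m q h \<sigma>) (diag_act m q h' \<sigma>')
    = diag_act m q (h \<circ> h') (\<sigma> \<circ> \<sigma>')"
proof
  fix \<alpha>
  have "inv' (\<sigma> \<circ> \<sigma>') = inv' \<sigma>' \<circ> inv' \<sigma>"
    using assms(2,3) by (intro o_inv_distrib) (auto intro: permutes_bij)
  moreover have "inv' \<sigma> i \<in> {1..m}" if "i \<in> {1..m}" for i
    using that assms(2) by (simp only: permutes_inv_in_iff)
  ultimately show "compose (hamming_verts m q) (diag_act m q h \<sigma>) (diag_act m q h' \<sigma>') \<alpha>
    = diag_act m q (h \<circ> h') (\<sigma> \<circ> \<sigma>') \<alpha>"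
    using diag_act_in_verts[OF assms(1,3), of \<alpha>]
    by (cases "\<alpha> \<in> hamming_verts m q") (auto simp: compose_def diag_act_def fun_eq_iff)
qed

lemma diag_act_id: "diag_act m q id id = (\<lambda>\<alpha>\<in>hamming_verts m q. \<alpha>)"
  by (auto simp: diag_act_def hamming_verts_def fun_eq_iff PiE_iff extensional_def)

lemma diag_act_Bij:
  assumes "h permutes {1..q}" "\<sigma> permutes {1..m}"
  shows "diag_act m q h \<sigma> \<in> Bij (hamming_verts m q)"
proof -
  let ?V = "hamming_verts m q"
  note inv = permutes_inv[OF assms(1)] permutes_inv[OF assms(2)]
  have "compose ?V (diag_act m q (inv' h) (inv' \<sigma>)) (diag_act m q h \<sigma>) = (\<lambda>\<alpha>\<in>?V. \<alpha>)"
    "compose ?V (diag_act m q h \<sigma>) (diag_act m q (inv' h) (inv' \<sigma>)) = (\<lambda>\<alpha>\<in>?V. \<alpha>)"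
    using diag_act_compose[OF assms(1) inv(2) assms(2)] diag_act_compose[OF inv(1) assms(2) inv(2)]
    by (simp_all add: permutes_inv_o[OF assms(1)] permutes_inv_o[OF assms(2)] diag_act_id)
  then have "diag_act m q (inv' h) (inv' \<sigma>) (diag_act m q h \<sigma> \<alpha>) = \<alpha>"
    "diag_act m q h \<sigma> (diag_act m q (inv' h) (inv' \<sigma>) \<alpha>) = \<alpha>" if "\<alpha> \<in> ?V" for \<alpha>
    using that by (metis compose_eq restrict_apply')+
  then have "bij_betw (diag_act m q h \<sigma>) ?V ?V"
    by (intro bij_betw_byWitness[where f' = "diag_act m q (inv' h) (inv' \<sigma>)"])
      (auto intro: diag_act_in_verts assms inv)
  then show ?thesis
    by (simp add: Bij_def diag_act_def)
qed

lemma diag_act_mult: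
  assumes "h permutes {1..q}" "h' permutes {1..q}" "\<sigma> permutes {1..m}" "\<sigma>' permutes {1..m}"
  shows "diag_act m q h \<sigma> \<otimes>\<^bsub>BijGroup (hamming_verts m q)\<^esub> diag_act m q h' \<sigma>'
    = diag_act m q (h \<circ> h') (\<sigma> \<circ> \<sigma>')"
  using assms by (simp add: BijGroup_def diag_act_Bij diag_act_compose)

lemma diag_act_inv:
  assumes "h permutes {1..q}" "\<sigma> permutes {1..m}"
  shows "inv\<^bsub>BijGroup (hamming_verts m q)\<^esub> (diag_act m q h \<sigma>) = diag_act m q (inv' h) (inv' \<sigma>)"
proof -
  note inv = permutes_inv[OF assms(1)] permutes_inv[OF assms(2)]
  have "diag_act m q (inv' h) (inv' \<sigma>) \<otimes>\<^bsub>BijGroup (hamming_verts m q)\<^esub> diag_act m q h \<sigma>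
    = \<one>\<^bsub>BijGroup (hamming_verts m q)\<^esub>"
    using diag_act_mult[OF inv(1) assms(1) inv(2) assms(2)]
    by (simp add: permutes_inv_o[OF assms(1)] permutes_inv_o[OF assms(2)] diag_act_id BijGroup_def)
  then show ?thesis
    by (intro group.inv_equality[OF group_BijGroup])
      (auto simp: BijGroup_def intro: diag_act_Bij assms inv)
qed

text \<open>Injectivity of \<open>h\<close> keeps disagreements as they are and
  \<open>\<sigma>\<close> only moves their positions, so their number is preserved.\<close>

lemma hamming_adj_diag_act:
  assumes "h permutes {1..q}" "\<sigma> permutes {1..m}"
    and "\<alpha> \<in> hamming_verts m q" "\<beta> \<in> hamming_verts m q"
  shows "hamming_adj m q (diag_act m q h \<sigma> \<alpha>) (diag_act m q h \<sigma> \<beta>) \<longleftrightarrow> hamming_adj m q \<alpha> \<beta>"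
proof -
  have "{i \<in> {1..m}. diag_act m q h \<sigma> \<alpha> i \<noteq> diag_act m q h \<sigma> \<beta> i}
    = {i \<in> {1..m}. \<alpha> (inv' \<sigma> i) \<noteq> \<beta> (inv' \<sigma> i)}"
    using assms(3,4) inj_eq[OF permutes_inj[OF assms(1)]] by (auto simp: diag_act_apply)
  also have "\<dots> = \<sigma> ` {i \<in> {1..m}. \<alpha> i \<noteq> \<beta> i}"
  proof (intro equalityI subsetI)
    fix i
    assume "i \<in> {i \<in> {1..m}. \<alpha> (inv' \<sigma> i) \<noteq> \<beta> (inv' \<sigma> i)}"
    then have "inv' \<sigma> i \<in> {i \<in> {1..m}. \<alpha> i \<noteq> \<beta> i}" "i = \<sigma> (inv' \<sigma> i)"
      using permutes_inv_in_iff[OF assms(2)] permutes_inverses[OF assms(2)] by auto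
    then show "i \<in> \<sigma> ` {i \<in> {1..m}. \<alpha> i \<noteq> \<beta> i}"
      by (rule image_eqI[rotated])
  next
    fix i
    assume "i \<in> \<sigma> ` {i \<in> {1..m}. \<alpha> i \<noteq> \<beta> i}"
    then show "i \<in> {i \<in> {1..m}. \<alpha> (inv' \<sigma> i) \<noteq> \<beta> (inv' \<sigma> i)}"
      using permutes_in_image[OF assms(2)] permutes_inverses[OF assms(2)] by auto
  qed
  finally have "card {i \<in> {1..m}. diag_act m q h \<sigma> \<alpha> i \<noteq> diag_act m q h \<sigma> \<beta> i}
    = card {i \<in> {1..m}. \<alpha> i \<noteq> \<beta> i}"
    by (simp add: card_image permutes_inj_on[OF assms(2)])
  then show ?thesis
    using assms by (simp add: hamming_adj_def diag_act_in_verts)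
qed

lemma diag_act_hamming_aut:
  "h permutes {1..q} \<Longrightarrow> \<sigma> permutes {1..m} \<Longrightarrow> diag_act m q h \<sigma> \<in> carrier (hamming_aut m q)"
  by (simp add: hamming_aut_def diag_act_Bij hamming_adj_diag_act)

section \<open>Automorphisms as a subgroup of all bijections of the vertex set\<close>

lemma subgroup_hamming_aut:
  "subgroup (carrier (hamming_aut m q)) (BijGroup (hamming_verts m q))"
proof (rule group.subgroupI[OF group_BijGroup])
  let ?V = "hamming_verts m q"
  show "carrier (hamming_aut m q) \<subseteq> carrier (BijGroup ?V)"
    by (auto simp: hamming_aut_def BijGroup_def)
  show "carrier (hamming_aut m q) \<noteq> {}"
    using diag_act_hamming_aut[OF permutes_id permutes_id] by blast
  fix f
  assume f: "f \<in> carrier (hamming_aut m q)"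
  then have fB: "f \<in> Bij ?V" and adj: "\<And>\<alpha> \<beta>. \<lbrakk>\<alpha> \<in> ?V; \<beta> \<in> ?V\<rbrakk> \<Longrightarrow>
    hamming_adj m q (f \<alpha>) (f \<beta>) \<longleftrightarrow> hamming_adj m q \<alpha> \<beta>"
    by (auto simp: hamming_aut_def)
  \<comment> \<open>The equivalence for \<open>f\<close>, read at preimages, is the equivalence for
    the inverse.\<close>
  have "f (inv_into ?V f \<alpha>) = \<alpha>" "inv_into ?V f \<alpha> \<in> ?V" if "\<alpha> \<in> ?V" for \<alpha>
    using that fB Bij_inv_into_mem[OF fB that] by (auto simp: Bij_def bij_betw_def f_inv_into_f)
  then have "hamming_adj m q (inv_into ?V f \<alpha>) (inv_into ?V f \<beta>) \<longleftrightarrow> hamming_adj m q \<alpha> \<beta>"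
    if "\<alpha> \<in> ?V" "\<beta> \<in> ?V" for \<alpha> \<beta>
    using that adj by metis
  then show "inv\<^bsub>BijGroup ?V\<^esub> f \<in> carrier (hamming_aut m q)"
    using fB by (simp add: inv_BijGroup hamming_aut_def restrict_inv_into_Bij)
  fix g
  assume "g \<in> carrier (hamming_aut m q)"
  then show "f \<otimes>\<^bsub>BijGroup ?V\<^esub> g \<in> carrier (hamming_aut m q)"
    using fB adj by (auto simp: hamming_aut_def BijGroup_def compose_Bij compose_eq
        Bij_imp_funcset[THEN funcset_mem])
qed

lemma hamming_aut_BijGroup:
  "hamming_aut m q = (BijGroup (hamming_verts m q))\<lparr>carrier := carrier (hamming_aut m q)\<rparr>"
  by (simp add: hamming_aut_def)

text \<open>Lets products and inverses be computed in \<open>BijGroup\<close>, whose operations have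
  explicit formulas.\<close>

lemma subgroup_hamming_aut_iff:
  "subgroup X (hamming_aut m q) \<longleftrightarrow>
    subgroup X (BijGroup (hamming_verts m q)) \<and> X \<subseteq> carrier (hamming_aut m q)"
  using group.incl_subgroup[OF group_BijGroup subgroup_hamming_aut, of X m q]
    group.subgroup_incl[OF group_BijGroup _ subgroup_hamming_aut, of X m q]
    subgroup.subset[of X "hamming_aut m q"]
  by (metis hamming_aut_BijGroup)

lemma diag_semidirect_eq:
  "diag_semidirect m q = {diag_act m q h \<sigma> | h \<sigma>. h permutes {1..q} \<and> \<sigma> permutes {1..m}}"
proof -
  let ?V = "hamming_verts m q"
  have coord: "coord_act m q \<sigma> = diag_act m q id \<sigma>" for \<sigma>
    by (simp add: coord_act_def diag_act_def)
  have base: "base_act m q (\<lambda>_. h) = diag_act m q h id" for h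
    by (simp add: base_act_def diag_act_def)
  have mult: "mult (hamming_aut m q) = mult (BijGroup ?V)"
    by (simp add: hamming_aut_def)
  have "coord_act m q \<sigma> \<otimes>\<^bsub>hamming_aut m q\<^esub> base_act m q (\<lambda>_. h) = diag_act m q h \<sigma>"
    if "h permutes {1..q}" "\<sigma> permutes {1..m}" for h \<sigma>
    using diag_act_mult[OF permutes_id that(1,2) permutes_id] by (simp add: coord base mult)
  then show ?thesis
    by (force simp: diag_semidirect_def set_mult_def coord_group_def diag_group_def sym_group_carrier)
qed

section \<open>Orbits and stabilisers\<close>

text \<open>Describes orbits without a base point: being an orbit splits into invariance and
  transitivity, which are checked separately later.\<close>

lemma in_orbits_iff:
  assumes "subgroup X (hamming_aut m q)"
  shows "O' \<in> orbits ((hamming_aut m q)\<lparr>carrier := X\<rparr>) (hamming_verts m q) id \<longleftrightarrow>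
    O' \<noteq> {} \<and> O' \<subseteq> hamming_verts m q \<and> (\<forall>g\<in>X. \<forall>x\<in>O'. g x \<in> O') \<and> (\<forall>x\<in>O'. \<forall>y\<in>O'. \<exists>g\<in>X. g x = y)"
    (is "?L \<longleftrightarrow> ?R")
proof
  let ?V = "hamming_verts m q"
  have sub: "subgroup X (BijGroup ?V)"
    using assms by (simp add: subgroup_hamming_aut_iff)
  have Bij: "g \<in> Bij ?V" if "g \<in> X" for g
    using subgroup.subset[OF sub] that by (auto simp: BijGroup_def)
  have mult: "(g \<otimes>\<^bsub>BijGroup ?V\<^esub> g') x = g (g' x)" if "g \<in> X" "g' \<in> X" "x \<in> ?V" for g g' x
    using that by (simp add: BijGroup_def Bij compose_eq)
  show ?R if ?L
  proof -
    obtain x where x: "x \<in> ?V" "O' = {g x | g. g \<in> X}"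
      using \<open>?L\<close> by (auto simp: orbits_def orbit_def)
    have "\<one>\<^bsub>BijGroup ?V\<^esub> x \<in> O'"
      using x(2) subgroup.one_closed[OF sub] by blast
    moreover have "O' \<subseteq> ?V"
      using x Bij Bij_imp_funcset by fastforce
    moreover have "g y \<in> O'" if g: "g \<in> X" and y: "y \<in> O'" for g y
    proof -
      obtain g' where "g' \<in> X" "y = g' x"
        using x(2) y by blast
      then have "g y = (g \<otimes>\<^bsub>BijGroup ?V\<^esub> g') x"
        using g x(1) by (simp add: mult)
      then show ?thesis
        using x(2) subgroup.m_closed[OF sub g \<open>g' \<in> X\<close>] by blast
    qed
    moreover have "\<exists>g\<in>X. g y = z" if y: "y \<in> O'" and z: "z \<in> O'" for y z
    proof -
      \<comment> \<open>The element moving \<open>g x\<close> to \<open>g' x\<close> is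
        \<open>g'\<close> after the inverse of \<open>g\<close>.\<close>
      obtain g g' where g: "g \<in> X" "y = g x" "g' \<in> X" "z = g' x"
        using x(2) y z by blast
      let ?i = "inv\<^bsub>BijGroup ?V\<^esub> g"
      have i: "?i \<in> X"
        using subgroup.m_inv_closed[OF sub g(1)] .
      have yV: "y \<in> ?V"
        using \<open>O' \<subseteq> ?V\<close> y by blast
      have "?i \<otimes>\<^bsub>BijGroup ?V\<^esub> g = \<one>\<^bsub>BijGroup ?V\<^esub>"
        using subgroup.subset[OF sub] g(1) by (intro group.l_inv[OF group_BijGroup]) blast
      moreover have "\<one>\<^bsub>BijGroup ?V\<^esub> x = x"
        using x(1) by (simp add: BijGroup_def)
      ultimately have "?i y = x"
        using mult[OF i g(1) x(1)] g(2) by simp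
      then have "(g' \<otimes>\<^bsub>BijGroup ?V\<^esub> ?i) y = z"
        using mult[OF g(3) i yV] g(4) by simp
      then show ?thesis
        using subgroup.m_closed[OF sub g(3) i] by blast
    qed
    ultimately show ?thesis
      by blast
  qed
  show ?L if ?R
  proof -
    obtain x where x: "x \<in> O'"
      using \<open>?R\<close> by blast
    have "O' = {g x | g. g \<in> X}"
    proof (intro equalityI subsetI)
      fix y
      assume "y \<in> O'"
      then obtain g where "g \<in> X" "g x = y"
        using \<open>?R\<close> x by metis
      then show "y \<in> {g x | g. g \<in> X}"
        by blast
    next
      fix y
      assume "y \<in> {g x | g. g \<in> X}"
      then obtain g where "g \<in> X" "y = g x"
        by blast
      then show "y \<in> O'"
        using \<open>?R\<close> x by simp
    qed
    moreover have "x \<in> hamming_verts m q"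
      using \<open>?R\<close> x by blast
    ultimately show ?thesis
      unfolding orbits_def orbit_def by auto
  qed
qed

text \<open>The largest candidate for the acting group: any group of diagonal automorphisms having
  \<open>C\<close> as an orbit lies in it.\<close>

definition diag_stabiliser :: "nat \<Rightarrow> nat \<Rightarrow> (nat \<Rightarrow> nat) set \<Rightarrow> ((nat \<Rightarrow> nat) \<Rightarrow> (nat \<Rightarrow> nat)) set" where
  "diag_stabiliser m q C = {g \<in> diag_semidirect m q. g ` C = C}"

lemma subgroup_diag_stabiliser:
  assumes "C \<subseteq> hamming_verts m q"
  shows "subgroup (diag_stabiliser m q C) (hamming_aut m q)"
proof -
  let ?V = "hamming_verts m q"
  have "subgroup (diag_stabiliser m q C) (BijGroup ?V)"
  proof (rule group.subgroupI[OF group_BijGroup])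
    show "diag_stabiliser m q C \<subseteq> carrier (BijGroup ?V)"
      by (auto simp: diag_stabiliser_def diag_semidirect_eq BijGroup_def diag_act_Bij)
    have "diag_act m q id id ` C = C"
      using assms by (force simp: diag_act_id)
    then show "diag_stabiliser m q C \<noteq> {}"
      unfolding diag_stabiliser_def diag_semidirect_eq using permutes_id by blast
    fix g
    assume g: "g \<in> diag_stabiliser m q C"
    then obtain h \<sigma> where h: "g = diag_act m q h \<sigma>" "h permutes {1..q}" "\<sigma> permutes {1..m}"
      and gC: "g ` C = C"
      by (auto simp: diag_stabiliser_def diag_semidirect_eq)
    have gB: "g \<in> Bij ?V"
      using h by (simp add: diag_act_Bij)
    let ?i = "inv\<^bsub>BijGroup ?V\<^esub> g"
    have "?i ` C = C"
    proof -
      have "?i (g x) = x" if "x \<in> ?V" for x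
        using that gB by (simp add: inv_BijGroup Bij_imp_funcset[THEN funcset_mem])
          (simp add: Bij_def bij_betw_def inv_into_f_f)
      then have "?i ` g ` C = C"
        using assms by (force simp: image_image)
      then show ?thesis
        by (simp add: gC)
    qed
    moreover have "?i \<in> diag_semidirect m q"
      using diag_act_inv[OF h(2,3)] h by (auto simp: diag_semidirect_eq intro: permutes_inv)
    ultimately show "?i \<in> diag_stabiliser m q C"
      by (simp add: diag_stabiliser_def)
    fix g'
    assume "g' \<in> diag_stabiliser m q C"
    then obtain h' \<sigma>' where h': "g' = diag_act m q h' \<sigma>'" "h' permutes {1..q}" "\<sigma>' permutes {1..m}"
      and g'C: "g' ` C = C"
      by (auto simp: diag_stabiliser_def diag_semidirect_eq)
    have g'B: "g' \<in> Bij ?V"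
      using h' by (simp add: diag_act_Bij)
    have "(g \<otimes>\<^bsub>BijGroup ?V\<^esub> g') x = g (g' x)" if "x \<in> C" for x
      using assms that gB g'B by (auto simp: BijGroup_def compose_eq)
    then have "(g \<otimes>\<^bsub>BijGroup ?V\<^esub> g') ` C = g ` g' ` C"
      by (auto simp: image_image)
    moreover have "g \<otimes>\<^bsub>BijGroup ?V\<^esub> g' \<in> diag_semidirect m q"
      using diag_act_mult[OF h(2) h'(2) h(3) h'(3)] h h'
      by (auto simp: diag_semidirect_eq intro: permutes_compose)
    ultimately show "g \<otimes>\<^bsub>BijGroup ?V\<^esub> g' \<in> diag_stabiliser m q C"
      by (simp add: diag_stabiliser_def gC g'C)
  qed
  moreover have "diag_stabiliser m q C \<subseteq> carrier (hamming_aut m q)"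
    by (auto simp: diag_stabiliser_def diag_semidirect_eq diag_act_hamming_aut)
  ultimately show ?thesis
    by (simp add: subgroup_hamming_aut_iff)
qed

text \<open>An injective map of a finite code into itself is onto, so one inclusion
  suffices.\<close>

lemma diag_stabiliserI:
  assumes "C \<subseteq> hamming_verts m q" "h permutes {1..q}" "\<sigma> permutes {1..m}"
    and "\<And>x. x \<in> C \<Longrightarrow> diag_act m q h \<sigma> x \<in> C"
  shows "diag_act m q h \<sigma> \<in> diag_stabiliser m q C"
proof -
  have "inj_on (diag_act m q h \<sigma>) C"
    using diag_act_Bij[OF assms(2,3)] assms(1) by (auto simp: Bij_def bij_betw_def intro: inj_on_subset)
  moreover have "finite C"
    using assms(1) finite_hamming_verts finite_subset by blast
  ultimately have "diag_act m q h \<sigma> ` C = C"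
    using assms(4) by (intro endo_inj_surj) auto
  then show ?thesis
    using assms(2,3) by (auto simp: diag_stabiliser_def diag_semidirect_eq)
qed

lemma code_neighbours_closed:
  assumes "C \<subseteq> hamming_verts m q" "g \<in> carrier (hamming_aut m q)" "g ` C = C"
    and "\<beta> \<in> code_neighbours m q C"
  shows "g \<beta> \<in> code_neighbours m q C"
proof -
  let ?V = "hamming_verts m q"
  have g: "g \<in> Bij ?V" and adj: "\<And>\<alpha> \<beta>. \<lbrakk>\<alpha> \<in> ?V; \<beta> \<in> ?V\<rbrakk> \<Longrightarrow>
    hamming_adj m q (g \<alpha>) (g \<beta>) \<longleftrightarrow> hamming_adj m q \<alpha> \<beta>"
    using assms(2) by (auto simp: hamming_aut_def)
  obtain \<alpha> where \<alpha>: "\<beta> \<in> ?V" "\<beta> \<notin> C" "\<alpha> \<in> C" "hamming_adj m q \<alpha> \<beta>"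
    using assms(4) by (auto simp: code_neighbours_def)
  have "g \<beta> \<notin> C"
  proof
    assume "g \<beta> \<in> C"
    then obtain \<gamma> where "\<gamma> \<in> C" "g \<beta> = g \<gamma>"
      using assms(3) by (metis imageE)
    then show False
      using g \<alpha>(1,2) assms(1) by (auto simp: Bij_def bij_betw_def dest: inj_onD)
  qed
  moreover have "g \<beta> \<in> ?V"
    using g \<alpha>(1) Bij_imp_funcset by blast
  moreover have "g \<alpha> \<in> C" "hamming_adj m q (g \<alpha>) (g \<beta>)"
    using \<alpha> adj assms(1,3) by auto
  ultimately show ?thesis
    by (auto simp: code_neighbours_def)
qed

text \<open>With the stabiliser as acting group both sets are automatically invariant; nonemptiness
  and transitivity remain to be supplied.\<close>

lemma diagonally_neighbour_transitiveI:
  assumes "C \<subseteq> hamming_verts m q" "C \<noteq> {}" "code_neighbours m q C \<noteq> {}"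
    and "\<And>\<alpha> \<beta>. \<lbrakk>\<alpha> \<in> C; \<beta> \<in> C\<rbrakk> \<Longrightarrow> \<exists>g\<in>diag_stabiliser m q C. g \<alpha> = \<beta>"
    and "\<And>\<alpha> \<beta>. \<lbrakk>\<alpha> \<in> code_neighbours m q C; \<beta> \<in> code_neighbours m q C\<rbrakk> \<Longrightarrow>
      \<exists>g\<in>diag_stabiliser m q C. g \<alpha> = \<beta>"
  shows "diagonally_neighbour_transitive m q C"
proof -
  let ?X = "diag_stabiliser m q C"
  note sub = subgroup_diag_stabiliser[OF assms(1)]
  have "g \<alpha> \<in> C" if "g \<in> ?X" "\<alpha> \<in> C" for g \<alpha>
    using that by (auto simp: diag_stabiliser_def)
  moreover have "g \<beta> \<in> code_neighbours m q C" if "g \<in> ?X" "\<beta> \<in> code_neighbours m q C" for g \<beta>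
  proof (rule code_neighbours_closed[OF assms(1) _ _ that(2)])
    show "g \<in> carrier (hamming_aut m q)"
      using subgroup.subset[OF sub] that(1) by blast
    show "g ` C = C"
      using that(1) by (simp add: diag_stabiliser_def)
  qed
  moreover have "code_neighbours m q C \<subseteq> hamming_verts m q"
    by (auto simp: code_neighbours_def)
  ultimately have "neighbour_transitive m q ?X C"
    unfolding neighbour_transitive_def in_orbits_iff[OF sub] using sub assms by simp
  moreover have "?X \<subseteq> diag_semidirect m q"
    by (auto simp: diag_stabiliser_def)
  ultimately show ?thesis
    by (auto simp: diagonally_neighbour_transitive_def)
qed

section \<open>Neighbours of frequency permutation arrays\<close>

text \<open>Turns the count of disagreements into a changed position and a new letter, the data that
  the orbit arguments move around.\<close>

lemma hamming_adj_iff: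
  assumes "\<alpha> \<in> hamming_verts m q" "\<beta> \<in> hamming_verts m q"
  shows "hamming_adj m q \<alpha> \<beta> \<longleftrightarrow> (\<exists>k\<in>{1..m}. \<exists>b\<in>{1..q}. b \<noteq> \<alpha> k \<and> \<beta> = \<alpha>(k := b))"
proof
  assume "hamming_adj m q \<alpha> \<beta>"
  then obtain k where k: "{i \<in> {1..m}. \<alpha> i \<noteq> \<beta> i} = {k}"
    by (auto simp: hamming_adj_def card_1_singleton_iff)
  then have "k \<in> {1..m}" "\<beta> k \<noteq> \<alpha> k"
    by auto
  moreover have "\<beta> k \<in> {1..q}"
    using assms(2) \<open>k \<in> {1..m}\<close> unfolding hamming_verts_def by (rule PiE_mem)
  moreover have "\<beta> = \<alpha>(k := \<beta> k)"
  proof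
    fix i
    show "\<beta> i = (\<alpha>(k := \<beta> k)) i"
    proof (cases "i \<in> {1..m}")
      case True
      then have "\<alpha> i = \<beta> i" if "i \<noteq> k"
        using k that by blast
      then show ?thesis
        by simp
    next
      case False
      \<comment> \<open>Vertices are extensional, so both take the default value outside the index
        range.\<close>
      have "\<alpha> i = undefined" "\<beta> i = undefined"
        by (rule PiE_arb[OF assms(1)[unfolded hamming_verts_def] False])
          (rule PiE_arb[OF assms(2)[unfolded hamming_verts_def] False])
      moreover have "i \<noteq> k"
        using False \<open>k \<in> {1..m}\<close> by blast
      ultimately show ?thesis
        by simp
    qed
  qed
  ultimately show "\<exists>k\<in>{1..m}. \<exists>b\<in>{1..q}. b \<noteq> \<alpha> k \<and> \<beta> = \<alpha>(k := b)"
    by blast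
next
  assume "\<exists>k\<in>{1..m}. \<exists>b\<in>{1..q}. b \<noteq> \<alpha> k \<and> \<beta> = \<alpha>(k := b)"
  then obtain k b where "k \<in> {1..m}" "b \<noteq> \<alpha> k" "\<beta> = \<alpha>(k := b)"
    by blast
  then have "{i \<in> {1..m}. \<alpha> i \<noteq> \<beta> i} = {k}"
    by auto
  then show "hamming_adj m q \<alpha> \<beta>"
    using assms by (simp add: hamming_adj_def)
qed

text \<open>Changing one entry of a codeword changes the number of occurrences of a letter, so it always
  leaves the code.\<close>

lemma code_neighbours_fpa:
  assumes "frequency_permutation_array p q C"
  shows "code_neighbours (p * q) q C
    = {\<alpha>(k := b) | \<alpha> k b. \<alpha> \<in> C \<and> k \<in> {1..p * q} \<and> b \<in> {1..q} \<and> b \<noteq> \<alpha> k}"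
proof -
  have C: "C \<subseteq> hamming_verts (p * q) q"
    and card: "\<And>\<alpha> a. \<lbrakk>\<alpha> \<in> C; a \<in> {1..q}\<rbrakk> \<Longrightarrow> card {i \<in> {1..p * q}. \<alpha> i = a} = p"
    using assms by (auto simp: frequency_permutation_array_def)
  have "\<alpha>(k := b) \<notin> C" if "\<alpha> \<in> C" "k \<in> {1..p * q}" "b \<in> {1..q}" "b \<noteq> \<alpha> k" for \<alpha> k b
  proof
    assume "\<alpha>(k := b) \<in> C"
    then have "card {i \<in> {1..p * q}. (\<alpha>(k := b)) i = b} = p"
      using card that(3) by blast
    moreover have "{i \<in> {1..p * q}. (\<alpha>(k := b)) i = b} = insert k {i \<in> {1..p * q}. \<alpha> i = b}"
      using that by auto
    ultimately show False
      using card[OF that(1,3)] that(4) by simp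
  qed
  moreover have "\<alpha>(k := b) \<in> hamming_verts (p * q) q" "hamming_adj (p * q) q \<alpha> (\<alpha>(k := b))"
    if "\<alpha> \<in> C" "k \<in> {1..p * q}" "b \<in> {1..q}" "b \<noteq> \<alpha> k" for \<alpha> k b
    using that C hamming_verts_fun_upd[of \<alpha> "p * q" q k b] hamming_adj_iff[of \<alpha> "p * q" q "\<alpha>(k := b)"]
    by blast+
  moreover have "\<exists>k\<in>{1..p * q}. \<exists>b\<in>{1..q}. b \<noteq> \<alpha> k \<and> \<beta> = \<alpha>(k := b)"
    if "\<alpha> \<in> C" "hamming_adj (p * q) q \<alpha> \<beta>" for \<alpha> \<beta>
    using that hamming_adj_iff[of \<alpha> "p * q" q \<beta>] by (simp add: hamming_adj_def)
  ultimately show ?thesis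
    unfolding code_neighbours_def by blast
qed

section \<open>Repeated permutation codes\<close>

text \<open>Position inside a block of length \<open>q\<close>. The shifts before and after
  \<open>mod\<close> keep positions in \<open>{1..q}\<close>, so the last one is \<open>q\<close>
  and not 0.\<close>

definition block_pos :: "nat \<Rightarrow> nat \<Rightarrow> nat" where
  "block_pos q k = (k - 1) mod q + 1"

lemma block_pos_in: "q \<ge> 1 \<Longrightarrow> block_pos q k \<in> {1..q}"
  using mod_less_divisor[of q "k - 1"] by (simp add: block_pos_def Suc_le_eq)

lemma block_pos_self: "k \<in> {1..q} \<Longrightarrow> block_pos q k = k"
  by (auto simp: block_pos_def)

lemma block_pos_add: "j \<in> {1..q} \<Longrightarrow> block_pos q (d * q + j) = j"
  unfolding block_pos_def by (cases j) auto

lemma block_pos_decomp: "k \<ge> 1 \<Longrightarrow> k = (k - 1) div q * q + block_pos q k"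
  unfolding block_pos_def using div_mult_mod_eq[of "k - 1" q] by linarith

lemma block_add_in:
  fixes d p q j :: nat
  assumes "d < p" "j \<in> {1..q}"
  shows "d * q + j \<in> {1..p * q}"
proof -
  have "Suc d * q \<le> p * q"
    using assms(1) by (intro mult_right_mono) auto
  then show ?thesis
    using assms(2) by auto
qed

lemma block_index_less:
  fixes k p q :: nat
  assumes "k \<in> {1..p * q}"
  shows "(k - 1) div q < p"
  using assms by (intro less_mult_imp_div_less) auto

text \<open>Each of the \<open>p\<close> blocks contributes one index \<open>d * q + j\<close>, with
  \<open>d\<close> running from 0 to \<open>p - 1\<close>.\<close>

lemma card_block_pos:
  assumes "j \<in> {1..q}"
  shows "card {k \<in> {1..p * q}. block_pos q k = j} = p"
proof -
  have "{k \<in> {1..p * q}. block_pos q k = j} = (\<lambda>d. d * q + j) ` {..<p}"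
  proof (intro equalityI subsetI)
    fix k
    assume k: "k \<in> {k \<in> {1..p * q}. block_pos q k = j}"
    then have "k = (k - 1) div q * q + j"
      using block_pos_decomp[of k q] by auto
    then show "k \<in> (\<lambda>d. d * q + j) ` {..<p}"
      using k block_index_less[of k p q] by blast
  next
    fix k
    assume "k \<in> (\<lambda>d. d * q + j) ` {..<p}"
    then show "k \<in> {k \<in> {1..p * q}. block_pos q k = j}"
      using assms block_add_in block_pos_add by blast
  qed
  moreover have "inj_on (\<lambda>d. d * q + j) {..<p}"
    using assms by (auto simp: inj_on_def)
  ultimately show ?thesis
    by (simp add: card_image)
qed

text \<open>Apply \<open>\<tau>\<close> inside every block, then correct the image of
  \<open>k\<close> by a transposition that leaves block positions unchanged.\<close>

lemma ex_block_permutation: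
  assumes "q \<ge> 1" "\<tau> permutes {1..q}" "k \<in> {1..p * q}" "l \<in> {1..p * q}"
    and "block_pos q l = \<tau> (block_pos q k)"
  obtains \<sigma> where "\<sigma> permutes {1..p * q}" "\<sigma> k = l"
    and "\<And>i. i \<in> {1..p * q} \<Longrightarrow> block_pos q (\<sigma> i) = \<tau> (block_pos q i)"
proof -
  define \<rho> where "\<rho> i = (if i \<in> {1..p * q} then (i - 1) div q * q + \<tau> (block_pos q i) else i)" for i
  have \<tau>: "\<tau> (block_pos q i) \<in> {1..q}" for i
    using block_pos_in[OF assms(1)] by (simp only: permutes_in_image[OF assms(2)])
  have pos: "block_pos q (\<rho> i) = \<tau> (block_pos q i)" if "i \<in> {1..p * q}" for i
    using that block_pos_add[OF \<tau>] by (simp add: \<rho>_def)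
  have maps: "\<rho> i \<in> {1..p * q}" if "i \<in> {1..p * q}" for i
    using block_add_in[OF block_index_less[OF that] \<tau>[of i]] that by (simp only: \<rho>_def if_True)
  have inj: "inj_on \<rho> {1..p * q}"
  proof
    fix i j
    assume i: "i \<in> {1..p * q}" and j: "j \<in> {1..p * q}" and eq: "\<rho> i = \<rho> j"
    have "\<tau> (block_pos q i) = \<tau> (block_pos q j)"
      using pos i j eq by metis
    then have bp: "block_pos q i = block_pos q j"
      using permutes_inj[OF assms(2)] by (simp add: inj_eq)
    then have "(i - 1) div q = (j - 1) div q"
      using eq i j assms(1) by (simp add: \<rho>_def)
    then show "i = j"
      using bp block_pos_decomp[of i q] block_pos_decomp[of j q] i j by simp
  qed
  have "\<rho> ` {1..p * q} = {1..p * q}"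
    using maps inj by (intro endo_inj_surj) auto
  then have \<rho>: "\<rho> permutes {1..p * q}"
    using inj by (intro bij_imp_permutes) (auto simp: bij_betw_def \<rho>_def)
  \<comment> \<open>Both \<open>\<rho> k\<close> and \<open>l\<close> have block position
    \<open>\<tau> (block_pos q k)\<close>, so swapping them does not disturb the induced
    \<open>\<tau>\<close>.\<close>
  let ?\<sigma> = "transpose (\<rho> k) l \<circ> \<rho>"
  show thesis
  proof
    show "?\<sigma> permutes {1..p * q}"
      using \<rho> permutes_swap_id[OF maps[OF assms(3)] assms(4)] by (rule permutes_compose)
    show "?\<sigma> k = l"
      by simp
    have "block_pos q (transpose (\<rho> k) l j) = block_pos q j" for j
      using pos[OF assms(3)] assms(5) by (simp add: transpose_def)
    then show "block_pos q (?\<sigma> i) = \<tau> (block_pos q i)" if "i \<in> {1..p * q}" for i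
      using pos[OF that] by simp
  qed
qed

section \<open>Words of repeated permutation codes and their letter frequencies\<close>

lemma rep_perm_vertex:
  "q \<ge> 1 \<Longrightarrow> rep_vertex p q (perm_vertex q t) = (\<lambda>k\<in>{1..p * q}. t (block_pos q k))"
  using block_pos_in[of q]
  by (auto simp: rep_vertex_def concat_verts_def perm_vertex_def block_pos_def fun_eq_iff)

lemma Rep_perm_code:
  "q \<ge> 1 \<Longrightarrow> Rep_code p q (perm_code q T) = (\<lambda>t. \<lambda>k\<in>{1..p * q}. t (block_pos q k)) ` T"
  by (simp add: Rep_code_def perm_code_def image_image rep_perm_vertex)

lemma Rep_perm_code_1:
  assumes "q \<ge> 1"
  shows "Rep_code 1 q (perm_code q T) = perm_code q T"
proof -
  have "(\<lambda>k\<in>{1..1 * q}. t (block_pos q k)) = perm_vertex q t" for t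
    unfolding perm_vertex_def mult_1 by (rule restrict_ext) (simp add: block_pos_self)
  then show ?thesis
    unfolding Rep_perm_code[OF assms] by (simp add: perm_code_def)
qed

text \<open>In the word of \<open>t\<close>, the letter \<open>a\<close> stands exactly at the
  indices with block position \<open>inv' t a\<close>, one in each block.\<close>

lemma fpa_Rep_perm_code:
  assumes "q \<ge> 1" "T \<subseteq> carrier (sym_group q)"
  shows "frequency_permutation_array p q (Rep_code p q (perm_code q T))"
  unfolding frequency_permutation_array_def Rep_perm_code[OF assms(1)]
proof (intro conjI ballI image_subsetI)
  fix t
  assume "t \<in> T"
  then have t: "t permutes {1..q}"
    using assms(2) by (auto simp: sym_group_carrier)
  have "t (block_pos q k) \<in> {1..q}" for k
    using block_pos_in[OF assms(1)] by (simp only: permutes_in_image[OF t])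
  then show "(\<lambda>k\<in>{1..p * q}. t (block_pos q k)) \<in> hamming_verts (p * q) q"
    by (simp add: hamming_verts_def)
next
  fix \<alpha> a
  assume "\<alpha> \<in> (\<lambda>t. \<lambda>k\<in>{1..p * q}. t (block_pos q k)) ` T" and a: "a \<in> {1..q}"
  then obtain t where t: "t permutes {1..q}" "\<alpha> = (\<lambda>k\<in>{1..p * q}. t (block_pos q k))"
    using assms(2) by (auto simp: sym_group_carrier)
  have "t x = a \<longleftrightarrow> x = inv' t a" for x
    using permutes_inv_eq[OF t(1), of a x] by metis
  then have "{i \<in> {1..p * q}. \<alpha> i = a} = {i \<in> {1..p * q}. block_pos q i = inv' t a}"
    by (intro Collect_cong conj_cong refl) (simp add: t(2))
  moreover have "inv' t a \<in> {1..q}"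
    using a t(1) by (simp only: permutes_inv_in_iff)
  ultimately show "card {i \<in> {1..p * q}. \<alpha> i = a} = p"
    by (simp only: card_block_pos)
qed

section \<open>The normaliser and neighbour transitivity\<close>

text \<open>The library's normaliser asks for equality of \<open>T\<close> with its conjugate; since
  \<open>T\<close> is finite and conjugation is injective, inclusion is enough.\<close>

lemma normalizer_sym_group_iff:
  assumes "T \<subseteq> carrier (sym_group q)"
  shows "h \<in> normalizer (sym_group q) T \<longleftrightarrow>
    h permutes {1..q} \<and> (\<forall>t\<in>T. h \<circ> t \<circ> inv' h \<in> T)" (is "_ \<longleftrightarrow> _ \<and> ?R")
proof (cases "h permutes {1..q}")
  case True
  let ?c = "\<lambda>t. h \<circ> t \<circ> inv' h"
  have "h <#\<^bsub>sym_group q\<^esub> T #>\<^bsub>sym_group q\<^esub> inv\<^bsub>sym_group q\<^esub> h = ?c ` T"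
    using True by (auto simp: l_coset_def r_coset_def sym_group_mult sym_group_carrier)
  then have "h \<in> normalizer (sym_group q) T \<longleftrightarrow> ?c ` T = T"
    using True assms by (simp add: normalizer_def stabilizer_def sym_group_carrier)
  moreover have "?c ` T = T \<longleftrightarrow> ?R"
  proof
    assume ?R
    moreover have "finite T"
      using assms finite_permutations[of "{1..q}"] by (auto simp: sym_group_def intro: finite_subset)
    moreover have "inj_on ?c T"
    proof
      fix s t
      assume "?c s = ?c t"
      then have "inv' h \<circ> ?c s \<circ> h = inv' h \<circ> ?c t \<circ> h"
        by simp
      then show "s = t"
        using permutes_inverses[OF True] by (simp add: fun_eq_iff)
    qed
    ultimately show "?c ` T = T"
      by (intro endo_inj_surj) auto
  qed blast
  ultimately show ?thesis
    using True by simp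
next
  case False
  then show ?thesis
    by (simp add: normalizer_def stabilizer_def sym_group_carrier)
qed

text \<open>Treats all repetition numbers at once; \<open>p = 1\<close> later gives sufficiency for
  the original code.\<close>

lemma diagonally_neighbour_transitive_Rep:
  assumes "q \<ge> 2" "p \<ge> 1" and T: "subgroup T (sym_group q)"
    and two: "two_transitive_on (normalizer (sym_group q) T) {1..q}"
  shows "diagonally_neighbour_transitive (p * q) q (Rep_code p q (perm_code q T))"
proof -
  let ?m = "p * q"
  let ?C = "Rep_code p q (perm_code q T)"
  let ?\<alpha> = "\<lambda>t. \<lambda>k\<in>{1..?m}. t (block_pos q k)"
  have q: "q \<ge> 1"
    using assms(1) by simp
  note Tsub = subgroup.subset[OF T]
  have C: "?C = ?\<alpha> ` T"
    using q by (rule Rep_perm_code)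
  have Tperm: "t permutes {1..q}" if "t \<in> T" for t
    using Tsub that by (auto simp: sym_group_carrier)
  have Tcomp: "s \<circ> t \<in> T" if "s \<in> T" "t \<in> T" for s t
    using subgroup.m_closed[OF T that] by (simp add: sym_group_mult)
  have Tinv: "inv' t \<in> T" if "t \<in> T" for t
    using subgroup.m_inv_closed[OF T that] Tsub that by (auto simp: subsetD)
  have id: "id \<in> T"
    using subgroup.one_closed[OF T] by (simp add: sym_group_one)
  note fpa = fpa_Rep_perm_code[OF q Tsub, of p]
  then have CV: "?C \<subseteq> hamming_verts ?m q"
    by (simp add: frequency_permutation_array_def)
  have nbrs: "code_neighbours ?m q ?C
    = {\<alpha>(k := b) | \<alpha> k b. \<alpha> \<in> ?C \<and> k \<in> {1..?m} \<and> b \<in> {1..q} \<and> b \<noteq> \<alpha> k}"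
    by (rule code_neighbours_fpa[OF fpa])
  have m: "{1..q} \<subseteq> {1..?m}"
    using assms(2) by auto

  text \<open>The automorphism \<open>(h, \<sigma>)\<close> with \<open>\<sigma>\<close> inducing \<open>s\<^sup>-\<^sup>1 h t\<close> on block positions.\<close>
  have key: "\<exists>\<sigma>. \<sigma> permutes {1..?m} \<and> \<sigma> k = l \<and> diag_act ?m q h \<sigma> (?\<alpha> t) = ?\<alpha> s \<and>
      diag_act ?m q h \<sigma> \<in> diag_stabiliser ?m q ?C"
    if h: "h \<in> normalizer (sym_group q) T" and s: "s \<in> T" and t: "t \<in> T"
      and k: "k \<in> {1..?m}" and l: "l \<in> {1..?m}" and kl: "h (t (block_pos q k)) = s (block_pos q l)"
    for h s t k l
  proof -
    have hp: "h permutes {1..q}" and hT: "\<And>u. u \<in> T \<Longrightarrow> h \<circ> u \<circ> inv' h \<in> T"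
      using h Tsub by (auto simp: normalizer_sym_group_iff)
    note sp = Tperm[OF s] and tp = Tperm[OF t]
    let ?\<tau> = "inv' s \<circ> h \<circ> t"
    have \<tau>: "?\<tau> permutes {1..q}"
      using permutes_inv[OF sp] hp tp by (intro permutes_compose)
    have "block_pos q l = ?\<tau> (block_pos q k)"
      using kl permutes_inverses[OF sp] by simp
    then obtain \<sigma> where \<sigma>: "\<sigma> permutes {1..?m}" "\<sigma> k = l"
      "\<And>i. i \<in> {1..?m} \<Longrightarrow> block_pos q (\<sigma> i) = ?\<tau> (block_pos q i)"
      using ex_block_permutation[OF q \<tau> k l] by blast
    \<comment> \<open>The image is the word of \<open>h u \<tau>^-1\<close>. Expanding
      \<open>\<tau>^-1 = t^-1 h^-1 s\<close> and grouping shows a conjugate by \<open>h\<close> of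
      an element of \<open>T\<close>, times \<open>s\<close>; for \<open>u = t\<close> it collapses
      to \<open>s\<close>.\<close>
    have act: "diag_act ?m q h \<sigma> (?\<alpha> u) = ?\<alpha> (h \<circ> (u \<circ> inv' t) \<circ> inv' h \<circ> s)" if "u \<in> T" for u
    proof
      fix i
      have *: "h (u (block_pos q (inv' \<sigma> i))) = (h \<circ> (u \<circ> inv' t) \<circ> inv' h \<circ> s) (block_pos q i)"
        if i: "i \<in> {1..?m}"
      proof -
        have "inv' \<sigma> i \<in> {1..?m}"
          using i \<sigma>(1) by (simp only: permutes_inv_in_iff)
        then have "block_pos q i = ?\<tau> (block_pos q (inv' \<sigma> i))"
          using \<sigma>(3) permutes_inverses[OF \<sigma>(1)] by metis
        then show ?thesis
          using permutes_inverses[OF sp] permutes_inverses[OF tp] permutes_inverses[OF hp] by simp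
      qed
      have "?\<alpha> u \<in> hamming_verts ?m q"
        using CV that by (auto simp: C)
      with * show "diag_act ?m q h \<sigma> (?\<alpha> u) i = ?\<alpha> (h \<circ> (u \<circ> inv' t) \<circ> inv' h \<circ> s) i"
        using permutes_inv_in_iff[OF \<sigma>(1), of i]
        by (cases "i \<in> {1..?m}") (simp_all add: diag_act_def del: atLeastAtMost_iff)
    qed
    have "h \<circ> (u \<circ> inv' t) \<circ> inv' h \<circ> s \<in> T" if "u \<in> T" for u
      using that s t by (intro Tcomp hT Tinv)
    then have "diag_act ?m q h \<sigma> \<alpha> \<in> ?C" if "\<alpha> \<in> ?C" for \<alpha>
      using that act unfolding C by blast
    then have "diag_act ?m q h \<sigma> \<in> diag_stabiliser ?m q ?C"
      by (rule diag_stabiliserI[OF CV hp \<sigma>(1)])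
    moreover have "h \<circ> (t \<circ> inv' t) \<circ> inv' h \<circ> s = s"
      by (simp add: permutes_inv_o[OF tp] permutes_inv_o[OF hp])
    ultimately show ?thesis
      using \<sigma>(1,2) act[OF t] by auto
  qed

  show ?thesis
  proof (rule diagonally_neighbour_transitiveI[OF CV])
    show "?C \<noteq> {}"
      using id C by blast
    have "?\<alpha> id \<in> ?C"
      unfolding C using id by (rule imageI)
    \<comment> \<open>Replacing the first entry 1 of the identity word by 2 gives a neighbour; the
      letter 2 exists since \<open>q \<ge> 2\<close>.\<close>
    moreover have "(1::nat) \<in> {1..?m}" "(2::nat) \<in> {1..q}" "2 \<noteq> ?\<alpha> id 1"
      using assms(1,2) by (auto simp: block_pos_self)
    ultimately show "code_neighbours ?m q ?C \<noteq> {}"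
      unfolding nbrs by blast
  next
    fix \<alpha> \<beta>
    assume "\<alpha> \<in> ?C" "\<beta> \<in> ?C"
    then obtain t s where ts: "t \<in> T" "\<alpha> = ?\<alpha> t" "s \<in> T" "\<beta> = ?\<alpha> s"
      by (auto simp: C)
    \<comment> \<open>Chosen so that \<open>key\<close> applies with \<open>h = id\<close> and
      \<open>k = 1\<close>: the words of \<open>t\<close> and \<open>s\<close> carry the same letter
      at \<open>k\<close> and \<open>l\<close>.\<close>
    define l where "l = inv' s (t 1)"
    have "t 1 \<in> {1..q}"
      using assms(1) permutes_in_image[OF Tperm[OF ts(1)], of 1] by simp
    then have "l \<in> {1..q}"
      unfolding l_def using Tperm[OF ts(3)] by (simp only: permutes_inv_in_iff)
    then have l: "l \<in> {1..?m}" "block_pos q l = l"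
      using m block_pos_self by blast+
    have "s l = t 1"
      using permutes_inverses[OF Tperm[OF ts(3)]] by (simp add: l_def)
    have "id \<in> normalizer (sym_group q) T"
      using Tsub by (simp add: normalizer_sym_group_iff permutes_id)
    then have "\<exists>\<sigma>. diag_act ?m q id \<sigma> (?\<alpha> t) = ?\<alpha> s \<and> diag_act ?m q id \<sigma> \<in> diag_stabiliser ?m q ?C"
      using key[of id s t 1 l] ts(1,3) l \<open>s l = t 1\<close> assms(1,2) by (auto simp: block_pos_self)
    then show "\<exists>g\<in>diag_stabiliser ?m q ?C. g \<alpha> = \<beta>"
      using ts by blast
  next
    fix \<beta> \<gamma>
    assume "\<beta> \<in> code_neighbours ?m q ?C" "\<gamma> \<in> code_neighbours ?m q ?C"
    then obtain \<alpha> \<delta> k l b d where nb: "\<alpha> \<in> ?C" "\<delta> \<in> ?C"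
      "k \<in> {1..?m}" "l \<in> {1..?m}" "b \<in> {1..q}" "d \<in> {1..q}" "b \<noteq> \<alpha> k" "d \<noteq> \<delta> l"
      "\<beta> = \<alpha>(k := b)" "\<gamma> = \<delta>(l := d)"
      unfolding nbrs by blast
    then obtain t s where "t \<in> T" "\<alpha> = ?\<alpha> t" "s \<in> T" "\<delta> = ?\<alpha> s"
      by (auto simp: C)
    with nb have ts: "t \<in> T" "s \<in> T" "k \<in> {1..?m}" "l \<in> {1..?m}"
      "b \<in> {1..q}" "d \<in> {1..q}" "b \<noteq> ?\<alpha> t k" "d \<noteq> ?\<alpha> s l"
      "\<beta> = (?\<alpha> t)(k := b)" "\<gamma> = (?\<alpha> s)(l := d)"
      by blast+
    \<comment> \<open>The old and new letters at each changed entry form an ordered pair of distinct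
      letters, so 2-transitivity supplies \<open>h\<close>.\<close>
    have "t (block_pos q k) \<in> {1..q}" "s (block_pos q l) \<in> {1..q}"
      using block_pos_in[OF q] by (simp_all only: permutes_in_image[OF Tperm] ts(1,2))
    moreover have "t (block_pos q k) \<noteq> b" "s (block_pos q l) \<noteq> d"
      using ts by auto
    ultimately obtain h where h: "h \<in> normalizer (sym_group q) T"
      "h (t (block_pos q k)) = s (block_pos q l)" "h b = d"
      using two ts(5,6) unfolding two_transitive_on_def by meson
    obtain \<sigma> where \<sigma>: "\<sigma> permutes {1..?m}" "\<sigma> k = l" "diag_act ?m q h \<sigma> (?\<alpha> t) = ?\<alpha> s"
      "diag_act ?m q h \<sigma> \<in> diag_stabiliser ?m q ?C"
      using key[OF h(1) ts(2,1,3,4) h(2)] by blast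
    have "h permutes {1..q}" "?\<alpha> t \<in> hamming_verts ?m q"
      using h(1) Tsub CV ts(1) by (auto simp: C normalizer_sym_group_iff)
    \<comment> \<open>The unchanged word goes to the unchanged word, and
      \<open>\<sigma> k = l\<close>, \<open>h b = d\<close> match the changed entries.\<close>
    then have "diag_act ?m q h \<sigma> \<beta> = \<gamma>"
      using diag_act_fun_upd[OF _ \<sigma>(1) _ ts(3,5)] \<sigma>(2,3) h(3) ts(9,10) by simp
    then show "\<exists>g\<in>diag_stabiliser ?m q ?C. g \<beta> = \<gamma>"
      using \<sigma>(4) by blast
  qed
qed

section \<open>Necessity of 2-transitivity of the normaliser\<close>

text \<open>The vertex \<open>(1, \<dots>, q)\<close> with entry \<open>i\<close> replaced by \<open>j\<close> misses the letter \<open>i\<close> and repeats the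
  letter \<open>j\<close>, so \<open>(h, \<sigma>)\<close> can carry it to the vertex built from \<open>k\<close> and \<open>l\<close> only if \<open>h\<close> maps
  \<open>i\<close> to \<open>k\<close> and \<open>j\<close> to \<open>l\<close>.\<close>

lemma two_transitive_normalizer:
  assumes "q \<ge> 1" and T: "subgroup T (sym_group q)"
    and dnt: "diagonally_neighbour_transitive q q (perm_code q T)"
  shows "two_transitive_on (normalizer (sym_group q) T) {1..q}"
  unfolding two_transitive_on_def
proof (intro ballI impI)
  fix i j k l
  assume ijkl: "i \<in> {1..q}" "j \<in> {1..q}" "k \<in> {1..q}" "l \<in> {1..q}" "i \<noteq> j \<and> k \<noteq> l"
  let ?C = "perm_code q T"
  let ?\<iota> = "perm_vertex q id"
  note Tsub = subgroup.subset[OF T]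
  have Tperm: "t permutes {1..q}" if "t \<in> T" for t
    using Tsub that by (auto simp: sym_group_carrier)
  have Tcomp: "s \<circ> t \<in> T" if "s \<in> T" "t \<in> T" for s t
    using subgroup.m_closed[OF T that] by (simp add: sym_group_mult)
  have Tinv: "inv' t \<in> T" if "t \<in> T" for t
    using subgroup.m_inv_closed[OF T that] Tsub that by (auto simp: subsetD)
  have id: "id \<in> T"
    using subgroup.one_closed[OF T] by (simp add: sym_group_one)
  obtain X where X: "X \<subseteq> diag_semidirect q q" "neighbour_transitive q q X ?C"
    using dnt by (auto simp: diagonally_neighbour_transitive_def)
  then have sub: "subgroup X (hamming_aut q q)" and CV: "?C \<subseteq> hamming_verts q q"
    by (simp_all add: neighbour_transitive_def)
  have stab: "\<forall>g\<in>X. \<forall>\<alpha>\<in>?C. g \<alpha> \<in> ?C"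
    and trans: "\<forall>\<beta>\<in>code_neighbours q q ?C. \<forall>\<gamma>\<in>code_neighbours q q ?C. \<exists>g\<in>X. g \<beta> = \<gamma>"
    using X(2) by (simp_all add: neighbour_transitive_def in_orbits_iff[OF sub])
  have \<iota>: "?\<iota> \<in> ?C"
    using id by (auto simp: perm_code_def)
  have "frequency_permutation_array 1 q ?C"
    using fpa_Rep_perm_code[OF assms(1) Tsub, of 1] unfolding Rep_perm_code_1[OF assms(1)] .
  then have nbrs: "code_neighbours q q ?C
    = {\<alpha>(k := b) | \<alpha> k b. \<alpha> \<in> ?C \<and> k \<in> {1..q} \<and> b \<in> {1..q} \<and> b \<noteq> \<alpha> k}"
    by (rule code_neighbours_fpa[of 1 q ?C, unfolded mult_1])
  have "?\<iota>(i := j) \<in> code_neighbours q q ?C" "?\<iota>(k := l) \<in> code_neighbours q q ?C"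
  proof -
    have "j \<noteq> ?\<iota> i" "l \<noteq> ?\<iota> k"
      using ijkl by (auto simp: perm_vertex_def)
    then show "?\<iota>(i := j) \<in> code_neighbours q q ?C" "?\<iota>(k := l) \<in> code_neighbours q q ?C"
      unfolding nbrs using \<iota> ijkl(1-4) by blast+
  qed
  then obtain g where g: "g \<in> X" "g (?\<iota>(i := j)) = ?\<iota>(k := l)"
    using trans by blast
  obtain h \<sigma> where h: "g = diag_act q q h \<sigma>" "h permutes {1..q}" "\<sigma> permutes {1..q}"
    using X(1) g(1) by (auto simp: diag_semidirect_eq)

  \<comment> \<open>\<open>C\<close> is an orbit of \<open>X\<close>, so \<open>g\<close> sends the
    word of \<open>t\<close> to a codeword. Equality of words gives equality of functions, as all
    permutations involved fix every point outside \<open>{1..q}\<close>.\<close>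
  have act: "h \<circ> t \<circ> inv' \<sigma> \<in> T" if t: "t \<in> T" for t
  proof -
    have "perm_vertex q t \<in> ?C"
      using t by (simp add: perm_code_def)
    then have "g (perm_vertex q t) \<in> ?C"
      using stab g(1) by simp
    then obtain s where s: "s \<in> T" "g (perm_vertex q t) = perm_vertex q s"
      by (auto simp: perm_code_def)
    have "h (t (inv' \<sigma> x)) = s x" if x: "x \<in> {1..q}" for x
    proof -
      have "inv' \<sigma> x \<in> {1..q}"
        using x h(3) by (simp only: permutes_inv_in_iff)
      moreover have "perm_vertex q t \<in> hamming_verts q q"
        using CV t by (auto simp: perm_code_def)
      ultimately show ?thesis
        using fun_cong[OF s(2), of x] x by (simp add: h(1) diag_act_apply) (simp add: perm_vertex_def)
    qed
    moreover have "h (t (inv' \<sigma> x)) = s x" if "x \<notin> {1..q}" for x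
      using that permutes_not_in[OF h(2)] permutes_not_in[OF Tperm[OF t]]
        permutes_not_in[OF permutes_inv[OF h(3)]] permutes_not_in[OF Tperm[OF s(1)]] by metis
    ultimately have "h \<circ> t \<circ> inv' \<sigma> = s"
      by (metis comp_apply ext)
    then show ?thesis
      using s(1) by simp
  qed
  have "h \<circ> t \<circ> inv' h \<in> T" if "t \<in> T" for t
  proof -
    \<comment> \<open>The case \<open>t = id\<close> puts \<open>h \<sigma>^-1\<close> into
      \<open>T\<close>; multiplying \<open>h t \<sigma>^-1\<close> by its inverse cancels
      \<open>\<sigma>\<close> and leaves the conjugate of \<open>t\<close>.\<close>
    have "inv' (h \<circ> id \<circ> inv' \<sigma>) = \<sigma> \<circ> inv' h"
      using o_inv_distrib[OF permutes_bij[OF h(2)] permutes_bij[OF permutes_inv[OF h(3)]]]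
      by (simp add: permutes_inv_inv[OF h(3)])
    then have "(h \<circ> t \<circ> inv' \<sigma>) \<circ> (\<sigma> \<circ> inv' h) \<in> T"
      using Tcomp[OF act[OF that] Tinv[OF act[OF id]]] by simp
    moreover have "(h \<circ> t \<circ> inv' \<sigma>) \<circ> (\<sigma> \<circ> inv' h) = h \<circ> t \<circ> inv' h"
      using permutes_inverses[OF h(3)] by (simp add: fun_eq_iff)
    ultimately show ?thesis
      by simp
  qed
  then have hN: "h \<in> normalizer (sym_group q) T"
    using h(2) Tsub by (simp add: normalizer_sym_group_iff)

  \<comment> \<open>The equation for \<open>g\<close> is evaluated at \<open>\<sigma> x\<close>,
    where the inverse of \<open>\<sigma>\<close> cancels.\<close>
  have rel: "h ((?\<iota>(i := j)) x) = (?\<iota>(k := l)) (\<sigma> x)" if "x \<in> {1..q}" for x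
  proof -
    have "?\<iota>(i := j) \<in> hamming_verts q q"
      using \<iota> CV ijkl hamming_verts_fun_upd by blast
    moreover have "\<sigma> x \<in> {1..q}"
      using that by (simp only: permutes_in_image[OF h(3)])
    ultimately show ?thesis
      using fun_cong[OF g(2), of "\<sigma> x"] permutes_inverses[OF h(3)]
      by (simp add: h(1) diag_act_apply del: fun_upd_apply)
  qed
  have upd: "(?\<iota>(a := b)) x = (if x = a then b else x)" if "x \<in> {1..q}" for a b x
    using that by (simp add: perm_vertex_def)
  have "h i = k"
  proof (rule ccontr)
    assume "h i \<noteq> k"
    \<comment> \<open>If \<open>h i \<noteq> k\<close>, the target word carries \<open>h i\<close>
      at position \<open>h i\<close>; pulled back, the source word would carry \<open>i\<close> at
      \<open>x\<close>, but it misses \<open>i\<close>.\<close>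
    define x where "x = inv' \<sigma> (h i)"
    have hi: "h i \<in> {1..q}"
      using ijkl by (simp only: permutes_in_image[OF h(2)])
    then have x: "x \<in> {1..q}" "\<sigma> x = h i"
      unfolding x_def using permutes_inverses[OF h(3)] h(3) by (simp_all only: permutes_inv_in_iff)
    have "h ((?\<iota>(i := j)) x) = h i"
      using rel[OF x(1)] upd[OF hi, of k l] \<open>h i \<noteq> k\<close> x(2) by simp
    then have "(?\<iota>(i := j)) x = i"
      using permutes_inj[OF h(2)] by (simp only: inj_eq)
    then show False
      using upd[OF x(1), of i j] ijkl by (simp split: if_splits)
  qed
  moreover have "h j = l"
  proof -
    \<comment> \<open>The source word has \<open>j\<close> at positions \<open>i\<close> and
      \<open>j\<close>, so the target word has \<open>h j\<close> at two distinct positions; its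
      only repeated letter is \<open>l\<close>.\<close>
    have \<sigma>: "\<sigma> i \<in> {1..q}" "\<sigma> j \<in> {1..q}" "\<sigma> i \<noteq> \<sigma> j"
      using ijkl permutes_inj[OF h(3)] by (simp_all only: permutes_in_image[OF h(3)] inj_eq) simp
    have "h j = (?\<iota>(k := l)) (\<sigma> i)" "h j = (?\<iota>(k := l)) (\<sigma> j)"
      using rel[OF ijkl(1)] rel[OF ijkl(2)] upd[OF ijkl(1), of i j] upd[OF ijkl(2), of i j] ijkl by simp_all
    then show ?thesis
      using upd[OF \<sigma>(1), of k l] upd[OF \<sigma>(2), of k l] \<sigma>(3) by (simp split: if_splits)
  qed
  ultimately show "\<exists>x\<in>normalizer (sym_group q) T. x i = k \<and> x j = l"
    using hN by blast
qed

theorem theorem1p3: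
  fixes q :: nat and T :: "(nat \<Rightarrow> nat) set"
  assumes "q \<ge> 2"
    and "subgroup T (sym_group q)"
  shows "(diagonally_neighbour_transitive q q (perm_code q T) \<longleftrightarrow>
            two_transitive_on (normalizer (sym_group q) T) {1..q}) \<and>
         (\<forall>p::nat. p \<ge> 1 \<longrightarrow> diagonally_neighbour_transitive q q (perm_code q T) \<longrightarrow>
            frequency_permutation_array p q (Rep_code p q (perm_code q T)) \<and>
            diagonally_neighbour_transitive (p * q) q (Rep_code p q (perm_code q T)))"
proof -
  have q: "q \<ge> 1"
    using assms(1) by simp
  \<comment> \<open>Sufficiency is the case \<open>p = 1\<close>. The claim for general
    \<open>p\<close> then passes through 2-transitivity of the normaliser, not directly from one
    code to the other.\<close>
  have "diagonally_neighbour_transitive q q (perm_code q T)"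
    if "two_transitive_on (normalizer (sym_group q) T) {1..q}"
    using diagonally_neighbour_transitive_Rep[OF assms(1) order_refl assms(2) that]
    unfolding Rep_perm_code_1[OF q] mult_1 .
  then show ?thesis
    using two_transitive_normalizer[OF q assms(2)] diagonally_neighbour_transitive_Rep[OF assms(1) _ assms(2)]
      fpa_Rep_perm_code[OF q subgroup.subset[OF assms(2)]] by blast
qed

end
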